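(* Let $\Gamma$ be a graph with $P_3\leq\Gamma$ and let $v$ be a positive integer such that there exists a $(K_v,\Gamma)$-design. Then \[\eta_1(v)\leq\eta_2(v)\leq v+3.\]
   Context: All graphs are finite and simple; $\Gamma\leq K$ means $\Gamma$ is a subgraph of $K$ (or is isomorphic to one, when $\Gamma$ is an abstract graph). $P_3$ is the path on $3$ vertices. For a graph $K$ and $\Gamma\leq K$, a $(K,\Gamma)$-design is a set $\mathcal{B}$ of subgraphs of $K$, called blocks, each isomorphic to $\Gamma$, whose edge-sets partition $E(K)$. $K_n$ is the complete graph on a set of $n$ vertices (any $n$-element vertex set may be used); a $\Gamma$-design of order $n$ is a $(K_n,\Gamma)$-design. Given $\Gamma'\leq\Gamma$, a $(K,\Gamma)$-design $\mathcal{B}$ and a $(K',\Gamma')$-design $\mathcal{B}'$, a down-link from $\mathcal{B}$ to $\mathcal{B}'$ is a function $f:\mathcal{B}\to\mathcal{B}'$ such that $f(B)$ is a subgraph of $B$ for every $B\in\mathcal{B}$ (the vertex sets of $K$ and $K'$ need not coincide, and either may be the larger). Take $\Gamma'=P_3$. For $v$ such that a $(K_v,\Gamma)$-design exists: $\mathcal{L}_1\Gamma(v)$ is the set of all integers $n$ such that some $\Gamma$-design of order $v$ can be down-linked to a $P_3$-design of order $n$; $\mathcal{L}_2\Gamma(v)$ is the set of all integers $n$ such that every $\Gamma$-design of order $v$ can be down-linked to a $P_3$-design of order $n$. Put $\eta_i(v)=\inf\mathcal{L}_i\Gamma(v)$ for $i=1,2$. *)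

theory Defs
  imports
    Graph_Theory.Graph_Theory
    "HOL-Library.Disjoint_Sets"
    "HOL-Library.FuncSet"
    "HOL-Library.Extended_Nat"
    "HOL-Library.Infinite_Typeclass"
begin

text \<open>
  A finite simple graph is a \<open>pair_graph\<close>: a finite vertex set together with a symmetric,
  irreflexive set of arcs. The edge \<open>{x, y}\<close> is represented by the two arcs \<open>(x, y)\<close> and
  \<open>(y, x)\<close>. On symmetric arc sets, inclusion, disjointness and partition of edge sets are
  inclusion, disjointness and partition of arc sets, and graph isomorphism is \<open>digraph_iso\<close>.
\<close>

abbreviation subgraph_of :: "'a pair_pre_digraph \<Rightarrow> 'a pair_pre_digraph \<Rightarrow> bool" where
  "subgraph_of H G \<equiv> subgraph (with_proj H) (with_proj G)"

abbreviation isomorphic :: "'a pair_pre_digraph \<Rightarrow> 'b pair_pre_digraph \<Rightarrow> bool" where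
  "isomorphic G H \<equiv> digraph_iso (with_proj G) (with_proj H)"

definition embeds :: "'a pair_pre_digraph \<Rightarrow> 'b pair_pre_digraph \<Rightarrow> bool" where
  "embeds H G \<longleftrightarrow> (\<exists>H'. pair_graph H' \<and> subgraph_of H' G \<and> isomorphic H H')"

definition P\<^sub>3 :: "nat pair_pre_digraph" where
  "P\<^sub>3 = \<lparr> pverts = {0, 1, 2}, parcs = {(0, 1), (1, 0), (1, 2), (2, 1)} \<rparr>"

text \<open>
  Injectivity of \<^const>\<open>parcs\<close> on the blocks is needed because \<^const>\<open>partition_on\<close> speaks only
  about the set of all edge sets: distinct blocks must not share their edge set (which could
  otherwise happen for blocks with isolated vertices).
\<close>

definition graph_design ::
    "'a pair_pre_digraph \<Rightarrow> 'b pair_pre_digraph \<Rightarrow> 'a pair_pre_digraph set \<Rightarrow> bool" where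
  "graph_design K \<Gamma> \<B> \<longleftrightarrow>
     (\<forall>B\<in>\<B>. pair_graph B \<and> subgraph_of B K \<and> isomorphic \<Gamma> B) \<and>
     inj_on parcs \<B> \<and> partition_on (parcs K) (parcs ` \<B>)"

text \<open>The vertex set of the complete graph is any \<open>n\<close>-element set of elements of \<open>'a\<close>.\<close>

definition design_of_order ::
    "nat \<Rightarrow> 'b pair_pre_digraph \<Rightarrow> 'a pair_pre_digraph set \<Rightarrow> bool" where
  "design_of_order n \<Gamma> \<B> \<longleftrightarrow>
     (\<exists>K. pair_graph K \<and> complete_digraph n (with_proj K) \<and> graph_design K \<Gamma> \<B>)"

definition down_link ::
    "('a pair_pre_digraph \<Rightarrow> 'a pair_pre_digraph) \<Rightarrow>
     'a pair_pre_digraph set \<Rightarrow> 'a pair_pre_digraph set \<Rightarrow> bool" where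
  "down_link f \<B> \<B>' \<longleftrightarrow> f \<in> \<B> \<rightarrow> \<B>' \<and> (\<forall>B\<in>\<B>. subgraph_of (f B) B)"

definition down_linkable_to_order :: "'a pair_pre_digraph set \<Rightarrow> nat \<Rightarrow> bool" where
  "down_linkable_to_order \<B> n \<longleftrightarrow>
     (\<exists>\<B>' f. design_of_order n P\<^sub>3 \<B>' \<and> down_link f \<B> \<B>')"

text \<open>
  The designs live on the vertex type \<open>'a\<close> of \<open>\<Gamma>\<close>. This loses nothing when \<open>'a\<close> is infinite,
  which has to be assumed so that complete graphs of every order exist.
\<close>

definition L\<^sub>1 :: "'a pair_pre_digraph \<Rightarrow> nat \<Rightarrow> nat set" where
  "L\<^sub>1 \<Gamma> v =
     {n. \<exists>\<B> :: 'a pair_pre_digraph set. design_of_order v \<Gamma> \<B> \<and> down_linkable_to_order \<B> n}"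

definition L\<^sub>2 :: "'a pair_pre_digraph \<Rightarrow> nat \<Rightarrow> nat set" where
  "L\<^sub>2 \<Gamma> v =
     {n. \<forall>\<B> :: 'a pair_pre_digraph set. design_of_order v \<Gamma> \<B> \<longrightarrow> down_linkable_to_order \<B> n}"

text \<open>The infima are taken in \<^typ>\<open>enat\<close>, so that the infimum of the empty set is \<open>\<infinity>\<close>.\<close>

definition \<eta>\<^sub>1 :: "'a pair_pre_digraph \<Rightarrow> nat \<Rightarrow> enat" where
  "\<eta>\<^sub>1 \<Gamma> v = (INF n\<in>L\<^sub>1 \<Gamma> v. enat n)"

definition \<eta>\<^sub>2 :: "'a pair_pre_digraph \<Rightarrow> nat \<Rightarrow> enat" where
  "\<eta>\<^sub>2 \<Gamma> v = (INF n\<in>L\<^sub>2 \<Gamma> v. enat n)"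

end

theory Submission
  imports Defs
begin

text \<open>
  Choose a path on three vertices inside every block and adjoin one, two or three new vertices to
  the \<open>v\<close> old ones so that the new order is \<open>0\<close> or \<open>1\<close> modulo \<open>4\<close>. The edges of the bigger
  complete graph lying on no chosen path are then even in number, and a new vertex \<open>w\<close> is joined to
  all other vertices by such edges. Orient the remaining edges not at \<open>w\<close> arbitrarily, then direct
  each edge \<open>{x, w}\<close> so that the out-degree of \<open>x\<close> becomes even; the out-degree of \<open>w\<close> is even by
  parity. Pairing the arcs that leave each vertex decomposes these edges into paths, which together
  with the chosen ones form the required design.
\<close>

section \<open>Paths on three vertices\<close>

text \<open>The first argument is the centre of the path, so that a cherry is what two arcs leaving
  a common vertex span.\<close>

definition cherry :: "'a \<Rightarrow> 'a \<Rightarrow> 'a \<Rightarrow> 'a pair_pre_digraph" where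
  "cherry x y z = \<lparr> pverts = {x, y, z}, parcs = {(x, y), (y, x), (x, z), (z, x)} \<rparr>"

definition is_path3 :: "'a pair_pre_digraph \<Rightarrow> bool" where
  "is_path3 B \<longleftrightarrow> (\<exists>x y z. x \<noteq> y \<and> x \<noteq> z \<and> y \<noteq> z \<and> B = cherry x y z)"

lemma is_path3_cherry:
  "x \<noteq> y \<Longrightarrow> x \<noteq> z \<Longrightarrow> y \<noteq> z \<Longrightarrow> is_path3 (cherry x y z)"
  by (auto simp: is_path3_def)

lemma pair_graph_path3:
  assumes "is_path3 B"
  shows "pair_graph B"
proof -
  obtain x y z where B: "x \<noteq> y" "x \<noteq> z" "y \<noteq> z" "B = cherry x y z"
    using assms by (auto simp: is_path3_def)
  show ?thesis
    using B(1-3) unfolding B(4) cherry_def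
    by unfold_locales (auto simp: symmetric_def intro!: symI)
qed

lemma isomorphic_path3:
  assumes "is_path3 B"
  shows "isomorphic P\<^sub>3 B"
proof -
  obtain x y z where B: "x \<noteq> y" "x \<noteq> z" "y \<noteq> z" "B = cherry x y z"
    using assms by (auto simp: is_path3_def)
  \<comment> \<open>The centre of \<open>P\<^sub>3\<close> is \<open>1\<close>, that of the cherry
    is \<open>x\<close>.\<close>
  define h where "h i = (if i = 0 then y else if i = 1 then x else z)" for i :: nat
  define f where "f = \<lparr> iso_verts = h, iso_arcs = map_prod h h, iso_head = snd, iso_tail = fst \<rparr>"
  have "wf_digraph (with_proj P\<^sub>3)"
    by unfold_locales (auto simp: P\<^sub>3_def)
  then have "pre_digraph.digraph_isomorphism (with_proj P\<^sub>3) f"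
    using B(1-3) unfolding pre_digraph.digraph_isomorphism_def
    by (auto simp: f_def P\<^sub>3_def h_def inj_on_def)
  moreover have "with_proj B = app_iso f (with_proj P\<^sub>3)"
    unfolding B(4) by (auto simp: app_iso_def with_proj_def cherry_def f_def P\<^sub>3_def h_def)
  ultimately show ?thesis
    unfolding digraph_iso_def by blast
qed

text \<open>Reduces an isomorphism to its vertex map, which is all that is needed to carry a path
  from one graph to another.\<close>

lemma isomorphic_imp_injective_hom:
  assumes "isomorphic G H"
  shows "\<exists>h. inj_on h (pverts G) \<and> (\<forall>x y. (x, y) \<in> parcs G \<longrightarrow> (h x, h y) \<in> parcs H)"
proof -
  obtain f where f: "pre_digraph.digraph_isomorphism (with_proj G) f"
    and H: "with_proj H = app_iso f (with_proj G)"
    using assms by (auto simp: digraph_iso_def)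
  have inj: "inj_on (iso_verts f) (pverts G)"
    using f by (simp add: pre_digraph.digraph_isomorphism_def)
  have "arcs_ends (with_proj H) =
      (\<lambda>(u, v). (iso_verts f u, iso_verts f v)) ` arcs_ends (with_proj G)"
    unfolding H by (rule wf_digraph.arcs_ends_app_iso_eq[OF _ f])
      (use f in \<open>simp add: pre_digraph.digraph_isomorphism_def\<close>)
  then have "(iso_verts f x, iso_verts f y) \<in> parcs H" if "(x, y) \<in> parcs G" for x y
    using image_eqI[of _ "\<lambda>(u, v). (iso_verts f u, iso_verts f v)" "(x, y)", OF _ that] by simp
  with inj show ?thesis by (intro exI[of _ "iso_verts f"]) simp
qed

lemma subgraph_of_iff:
  assumes "pair_graph H" "pair_graph G"
  shows "subgraph_of H G \<longleftrightarrow> pverts H \<subseteq> pverts G \<and> parcs H \<subseteq> parcs G"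
proof -
  interpret H: pair_graph H by fact
  interpret G: pair_graph G by fact
  show ?thesis
    using H.wf_digraph G.wf_digraph by (auto simp: subgraph_def compatible_def)
qed

lemma cherry_subgraph_of:
  assumes "pair_graph G" "(x, y) \<in> parcs G" "(x, z) \<in> parcs G" "y \<noteq> z"
  shows "is_path3 (cherry x y z)" and "subgraph_of (cherry x y z) G"
proof -
  interpret pair_graph G by fact
  show path: "is_path3 (cherry x y z)"
    using assms(2-4) no_loops' by (metis is_path3_cherry)
  have "pverts (cherry x y z) \<subseteq> pverts G \<and> parcs (cherry x y z) \<subseteq> parcs G"
    using assms(2,3) by (auto simp: cherry_def dest: wellformed' arcs_symmetric)
  then show "subgraph_of (cherry x y z) G"
    using subgraph_of_iff[OF pair_graph_path3[OF path] assms(1)] by blast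
qed

text \<open>The path is carried first into \<open>\<Gamma>\<close> by \<open>h\<close> and then into
  the block by \<open>k\<close>, with centre \<open>k (h 1)\<close>. Injectivity of both maps keeps
  its two ends apart.\<close>

lemma embeds_path3_imp_subgraph:
  assumes "embeds P\<^sub>3 \<Gamma>" "isomorphic \<Gamma> B" "pair_graph \<Gamma>" "pair_graph B"
  shows "\<exists>C. is_path3 C \<and> subgraph_of C B"
proof -
  obtain H where H: "subgraph_of H \<Gamma>" "isomorphic P\<^sub>3 H"
    using assms(1) by (auto simp: embeds_def)
  obtain h where h: "inj_on h (pverts P\<^sub>3)"
      "\<forall>x y. (x, y) \<in> parcs P\<^sub>3 \<longrightarrow> (h x, h y) \<in> parcs H"
    using isomorphic_imp_injective_hom[OF H(2)] by metis
  obtain k where k: "inj_on k (pverts \<Gamma>)"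
      "\<forall>x y. (x, y) \<in> parcs \<Gamma> \<longrightarrow> (k x, k y) \<in> parcs B"
    using isomorphic_imp_injective_hom[OF assms(2)] by metis
  have arcs: "(h 1, h 0) \<in> parcs \<Gamma>" "(h 1, h 2) \<in> parcs \<Gamma>"
    using H(1) h(2)[rule_format, of 1 0] h(2)[rule_format, of 1 2] by (auto simp: P\<^sub>3_def subgraph_def)
  interpret \<Gamma>: pair_graph \<Gamma> by fact
  have "h 0 \<noteq> h 2"
    using h(1) by (auto simp: P\<^sub>3_def inj_on_def)
  then have "k (h 0) \<noteq> k (h 2)"
    using k(1) arcs by (auto dest: inj_onD \<Gamma>.wellformed')
  then show ?thesis
    using cherry_subgraph_of[OF assms(4) arcs[THEN k(2)[rule_format]]] by metis
qed

lemma parcs_path3: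
  assumes "is_path3 B"
  shows "pverts B = fst ` parcs B" and "parcs B \<noteq> {}" and "card (parcs B) = 4"
  using assms by (auto simp: is_path3_def cherry_def)

section \<open>Decompositions into paths\<close>

text \<open>The counterpart of \<open>graph_design\<close> for a bare arc set: without an ambient
  graph, the chosen paths and the remaining edges can be treated separately and united
  afterwards.\<close>

definition path3_decomposition :: "'a pair_pre_digraph set \<Rightarrow> ('a \<times> 'a) set \<Rightarrow> bool" where
  "path3_decomposition \<B> E \<longleftrightarrow>
     (\<forall>B\<in>\<B>. is_path3 B) \<and> inj_on parcs \<B> \<and> partition_on E (parcs ` \<B>)"

lemma path3_decompositionI:
  assumes "\<And>B. B \<in> \<B> \<Longrightarrow> is_path3 B"
    and "\<And>B C. B \<in> \<B> \<Longrightarrow> C \<in> \<B> \<Longrightarrow> B \<noteq> C \<Longrightarrow> parcs B \<inter> parcs C = {}"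
    and "(\<Union>B\<in>\<B>. parcs B) = E"
  shows "path3_decomposition \<B> E"
proof -
  have "inj_on parcs \<B>"
    using assms(1,2) parcs_path3(2) by (fastforce intro!: inj_onI)
  moreover have "partition_on E (parcs ` \<B>)"
  proof (rule partition_onI)
    show "{} \<notin> parcs ` \<B>"
      using assms(1) parcs_path3(2) by (metis imageE)
    show "disjnt p q" if "p \<in> parcs ` \<B>" "q \<in> parcs ` \<B>" "p \<noteq> q" for p q
      using that assms(2) unfolding disjnt_def by blast
  qed (use assms(3) in simp)
  ultimately show ?thesis
    using assms(1) by (simp add: path3_decomposition_def)
qed

lemma path3_decompositionD:
  assumes "path3_decomposition \<B> E"
  shows "\<And>B. B \<in> \<B> \<Longrightarrow> is_path3 B"
    and "\<And>B C. B \<in> \<B> \<Longrightarrow> C \<in> \<B> \<Longrightarrow> B \<noteq> C \<Longrightarrow> parcs B \<inter> parcs C = {}"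
    and "(\<Union>B\<in>\<B>. parcs B) = E"
proof -
  show "B \<in> \<B> \<Longrightarrow> is_path3 B" for B
    using assms by (simp add: path3_decomposition_def)
  show "parcs B \<inter> parcs C = {}" if "B \<in> \<B>" "C \<in> \<B>" "B \<noteq> C" for B C
  proof -
    have "parcs B \<noteq> parcs C"
      using assms that by (auto simp: path3_decomposition_def dest: inj_onD)
    then show ?thesis
      using assms that unfolding path3_decomposition_def
      by (metis disjointD partition_onD2 imageI)
  qed
  show "(\<Union>B\<in>\<B>. parcs B) = E"
    using assms by (simp add: path3_decomposition_def partition_on_def)
qed

lemma path3_decomposition_Un:
  assumes "path3_decomposition \<B> E" "path3_decomposition \<C> F" "E \<inter> F = {}"
  shows "path3_decomposition (\<B> \<union> \<C>) (E \<union> F)"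
proof (rule path3_decompositionI)
  note B = path3_decompositionD[OF assms(1)] and C = path3_decompositionD[OF assms(2)]
  show "is_path3 B" if "B \<in> \<B> \<union> \<C>" for B
    using that B(1) C(1) by blast
  show "parcs B \<inter> parcs C = {}" if "B \<in> \<B> \<union> \<C>" "C \<in> \<B> \<union> \<C>" "B \<noteq> C" for B C
    using that B(2)[of B C] C(2)[of B C] B(3) C(3) assms(3) by blast
  show "(\<Union>B\<in>\<B> \<union> \<C>. parcs B) = E \<union> F"
    using B(3) C(3) by blast
qed

text \<open>Each path has two edges, hence four arcs. In terms of arcs, divisibility by 4 thus
  expresses that the number of edges is even.\<close>

lemma four_dvd_card_path3_decomposition:
  assumes "path3_decomposition \<B> E" "finite E"
  shows "4 dvd card E"
proof -
  have "E = \<Union> (parcs ` \<B>)" "disjoint (parcs ` \<B>)"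
    using assms(1) by (auto simp: path3_decomposition_def partition_on_def)
  moreover have "\<forall>c\<in>parcs ` \<B>. 4 dvd card c"
    using path3_decompositionD(1)[OF assms(1)] parcs_path3(3) by fastforce
  ultimately show ?thesis
    using assms(2) by (metis dvd_partition disjoint_def)
qed

lemma graph_design_path3:
  assumes "pair_graph K" "path3_decomposition \<B> (parcs K)"
  shows "graph_design K P\<^sub>3 \<B>"
proof -
  interpret pair_graph K by fact
  have "subgraph_of B K" if "B \<in> \<B>" for B
  proof -
    have B: "is_path3 B" "parcs B \<subseteq> parcs K"
      using path3_decompositionD(1,3)[OF assms(2)] that by auto
    \<comment> \<open>A path has no isolated vertex, so containment of arcs forces containment of
      vertices.\<close>
    have "pverts B \<subseteq> pverts K"
      using B(2) wellformed' unfolding parcs_path3(1)[OF B(1)] by auto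
    with B show ?thesis
      using subgraph_of_iff[OF pair_graph_path3 assms(1)] by blast
  qed
  then show ?thesis
    using assms(2) unfolding graph_design_def path3_decomposition_def
    by (auto intro: pair_graph_path3 isomorphic_path3)
qed

text \<open>\<open>D\<close> is an orientation: it holds one arc of each edge. Two arcs leaving the
  same vertex form a path, and removing them lowers just one out-degree, by two, so induction on the
  number of arcs applies.\<close>

lemma even_out_degrees_path3_decomposition:
  assumes "finite D" "D \<inter> D\<inverse> = {}" "\<And>x. even (card (D `` {x}))"
  shows "\<exists>\<B>. path3_decomposition \<B> (D \<union> D\<inverse>)"
  using assms
proof (induction "card D" arbitrary: D rule: less_induct)
  case less
  show ?case
  proof (cases "D = {}")
    case True
    then have "path3_decomposition {} (D \<union> D\<inverse>)"
      by (intro path3_decompositionI) auto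
    then show ?thesis by blast
  next
    case False
    then obtain x y where xy: "(x, y) \<in> D" by auto
    have fin: "finite (D `` {x})"
      using less.prems(1) by (rule finite_Image)
    \<comment> \<open>An even out-degree is not 1, so a second arc leaves \<open>x\<close>.\<close>
    have "D `` {x} \<noteq> {y}"
      using less.prems(3)[of x] by (metis card.empty card_insert_if finite.emptyI empty_iff odd_one One_nat_def)
    then obtain z where xz: "(x, z) \<in> D" "y \<noteq> z"
      using xy by blast
    have neq: "x \<noteq> y" "x \<noteq> z"
      using xy xz(1) less.prems(2) by auto
    define D' where "D' = D - {(x, y), (x, z)}"
    have "D' `` {u} = (if u = x then D `` {x} - {y, z} else D `` {u})" for u
      by (auto simp: D'_def)
    moreover have "card (D `` {x} - {y, z}) = card (D `` {x}) - 2"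
      using xy xz fin by (subst card_Diff_subset) auto
    moreover have "even (n - 2)" if "even n" for n :: nat
      using that by simp
    ultimately have "even (card (D' `` {u}))" for u
      using less.prems(3)[of u] by metis
    moreover have "card D' < card D"
      using xy less.prems(1) unfolding D'_def by (intro psubset_card_mono) auto
    moreover have "finite D'" "D' \<inter> D'\<inverse> = {}"
      using less.prems(1,2) by (auto simp: D'_def)
    ultimately obtain \<B> where \<B>: "path3_decomposition \<B> (D' \<union> D'\<inverse>)"
      using less.hyps by blast
    have "path3_decomposition {cherry x y z} (parcs (cherry x y z))"
      using neq xz(2) by (intro path3_decompositionI) (auto intro: is_path3_cherry)
    \<comment> \<open>The reversed arcs of the removed path cannot survive in \<open>D'\<close>,
      because \<open>D\<close> never contains both arcs of an edge.\<close>
    moreover have "parcs (cherry x y z) \<inter> (D' \<union> D'\<inverse>) = {}"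
      using xy xz less.prems(2) by (auto simp: cherry_def D'_def)
    ultimately have "path3_decomposition ({cherry x y z} \<union> \<B>) (parcs (cherry x y z) \<union> (D' \<union> D'\<inverse>))"
      using \<B> path3_decomposition_Un by blast
    moreover have "parcs (cherry x y z) \<union> (D' \<union> D'\<inverse>) = D \<union> D\<inverse>"
      using xy xz(1) by (auto simp: cherry_def D'_def)
    ultimately show ?thesis by auto
  qed
qed

text \<open>The edges at \<open>w\<close> correct the parity at every other vertex; the parity at
  \<open>w\<close> itself is then forced, since \<open>E\<close> holds both arcs of each edge and
  \<open>4 dvd card E\<close> makes the number of edges even.\<close>

lemma apex_even_orientation:
  assumes "finite V" "E \<subseteq> V \<times> V" "sym E" "irrefl E" "4 dvd card E"
    and w: "w \<in> V" "\<And>x. x \<in> V \<Longrightarrow> x \<noteq> w \<Longrightarrow> (x, w) \<in> E"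
  obtains D where "D \<inter> D\<inverse> = {}" "D \<union> D\<inverse> = E" "\<And>x. even (card (D `` {x}))"
proof -
  \<comment> \<open>The vertex type carries no order, so an injective numbering of \<open>V\<close>
    serves to orient the edges away from \<open>w\<close>.\<close>
  obtain r :: "'a \<Rightarrow> nat" where r: "inj_on r V"
    using finite_imp_inj_to_nat_seg[OF assms(1)] by blast
  define D\<^sub>0 where "D\<^sub>0 = {(x, y) \<in> E. x \<noteq> w \<and> y \<noteq> w \<and> r x < r y}"
  \<comment> \<open>The vertices whose out-degree needs correction: they send an arc to
    \<open>w\<close>, all others receive one from it.\<close>
  define T where "T = {x \<in> V. x \<noteq> w \<and> odd (card (D\<^sub>0 `` {x}))}"
  define D where "D = D\<^sub>0 \<union> T \<times> {w} \<union> {w} \<times> (V - {w} - T)"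
  have E: "(x, y) \<in> E \<Longrightarrow> x \<in> V \<and> y \<in> V \<and> x \<noteq> y \<and> (y, x) \<in> E" for x y
    using assms(2-4) by (auto simp: irrefl_def dest: symD)
  have fin: "finite E"
    using assms(1,2) by (meson finite_SigmaI finite_subset)
  have T: "T \<subseteq> V - {w}"
    by (auto simp: T_def)
  have disj: "D \<inter> D\<inverse> = {}"
    using T by (auto simp: D_def D\<^sub>0_def)
  have cover: "D \<union> D\<inverse> = E"
  proof
    show "D \<union> D\<inverse> \<subseteq> E"
      using T E w(2) by (auto simp: D_def D\<^sub>0_def)
    show "E \<subseteq> D \<union> D\<inverse>"
    proof (rule subrelI)
      fix x y assume xy: "(x, y) \<in> E"
      then have "r x \<noteq> r y"
        using r E by (auto dest: inj_onD)
      then show "(x, y) \<in> D \<union> D\<inverse>"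
        using xy E[OF xy] by (cases "x = w"; cases "y = w") (auto simp: D_def D\<^sub>0_def)
    qed
  qed
  have finD: "finite D"
    using fin cover by (metis finite_Un)
  \<comment> \<open>\<open>D\<close> and its converse have equal size, so \<open>card E\<close> is
    twice \<open>card D\<close>.\<close>
  have "card E = card D + card (D\<inverse>)"
    unfolding cover[symmetric] using finD disj by (intro card_Un_disjoint) auto
  then have even_D: "even (card D)"
    using assms(5) by simp presburger
  have even: "even (card (D `` {x}))" if "x \<noteq> w" for x
  proof (cases "x \<in> T")
    case True
    then have "D `` {x} = insert w (D\<^sub>0 `` {x})"
      using that by (auto simp: D_def)
    moreover have "w \<notin> D\<^sub>0 `` {x}"
      by (auto simp: D\<^sub>0_def)
    moreover have "finite (D\<^sub>0 `` {x})"
      using finD by (intro finite_Image) (simp add: D_def)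
    ultimately show ?thesis
      using True by (simp add: T_def)
  next
    case False
    then have D: "D `` {x} = D\<^sub>0 `` {x}"
      using that by (auto simp: D_def)
    show ?thesis
    proof (cases "x \<in> V")
      case True
      then show ?thesis using False D that by (auto simp: T_def)
    next
      case False
      then have "D\<^sub>0 `` {x} = {}"
        using E by (auto simp: D\<^sub>0_def)
      then show ?thesis using D by simp
    qed
  qed
  \<comment> \<open>Sorting the arcs by tail, the out-degrees add up to the even number
    \<open>card D\<close>; as all terms except that of \<open>w\<close> are even, so is that
    one.\<close>
  have "D = (SIGMA x:V. D `` {x})"
    using cover E by (auto simp: set_eq_iff)
  then have "card D = (\<Sum>x\<in>V. card (D `` {x}))"
    using assms(1) finD by (metis card_SigmaI finite_Image)
  also have "\<dots> = card (D `` {w}) + (\<Sum>x\<in>V - {w}. card (D `` {x}))"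
    using assms(1) w(1) by (rule sum.remove)
  finally have "even (card (D `` {w}) + (\<Sum>x\<in>V - {w}. card (D `` {x})))"
    using even_D by simp
  moreover have "even (\<Sum>x\<in>V - {w}. card (D `` {x}))"
    using even by (intro dvd_sum) auto
  ultimately have "even (card (D `` {w}))"
    by simp
  with even disj cover show ?thesis
    by (metis that)
qed

section \<open>Down-linking to a larger complete graph\<close>

lemma card_off_diagonal:
  assumes "finite V"
  shows "card {(x, y). (x, y) \<in> V \<times> V \<and> x \<noteq> y} = card V * (card V - 1)"
proof -
  have "{(x, y). (x, y) \<in> V \<times> V \<and> x \<noteq> y} = (SIGMA x:V. V - {x})"
    by auto
  then show ?thesis
    using assms by simp
qed

text \<open>The down-link is the choice \<open>g\<close> of a path in each block. The hypothesis
  \<open>m > 0\<close> supplies the apex \<open>w\<close>, and the divisibility says that the larger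
  complete graph has an even number of edges.\<close>

lemma design_down_linkable:
  fixes \<Gamma> :: "'a::infinite pair_pre_digraph"
  assumes "pair_graph \<Gamma>" "embeds P\<^sub>3 \<Gamma>" "design_of_order v \<Gamma> (\<B> :: 'a pair_pre_digraph set)"
    and m: "m > 0" "4 dvd (v + m) * (v + m - 1)"
  shows "down_linkable_to_order \<B> (v + m)"
proof -
  obtain K where K: "pair_graph K" "complete_digraph v (with_proj K)" "graph_design K \<Gamma> \<B>"
    using assms(3) by (auto simp: design_of_order_def)
  have V: "finite (pverts K)" "card (pverts K) = v"
      "parcs K = {(x, y). (x, y) \<in> pverts K \<times> pverts K \<and> x \<noteq> y}"
    using K(2) by (auto simp: complete_digraph_pair_def)
  have block: "pair_graph B" "parcs B \<subseteq> parcs K" "isomorphic \<Gamma> B" if "B \<in> \<B>" for B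
    using K(3) that by (auto simp: graph_design_def subgraph_def)
  have disj_block: "parcs B \<inter> parcs C = {}" if "B \<in> \<B>" "C \<in> \<B>" "B \<noteq> C" for B C
  proof -
    have "parcs B \<noteq> parcs C"
      using K(3) that by (auto simp: graph_design_def dest: inj_onD)
    then show ?thesis
      using K(3) that unfolding graph_design_def
      by (metis disjointD partition_onD2 imageI)
  qed
  obtain g where g: "\<And>B. B \<in> \<B> \<Longrightarrow> is_path3 (g B)" "\<And>B. B \<in> \<B> \<Longrightarrow> subgraph_of (g B) B"
    using embeds_path3_imp_subgraph[OF assms(2) block(3) assms(1) block(1)] by metis
  have g_arcs: "parcs (g B) \<subseteq> parcs B" if "B \<in> \<B>" for B
    using g(2)[OF that] by (auto simp: subgraph_def)
  define F where "F = (\<Union>C\<in>g ` \<B>. parcs C)"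
  have F: "path3_decomposition (g ` \<B>) F"
  proof (rule path3_decompositionI)
    \<comment> \<open>Unequal chosen paths come from unequal blocks, whose arc sets are
      disjoint.\<close>
    show "parcs B \<inter> parcs C = {}" if BC: "B \<in> g ` \<B>" "C \<in> g ` \<B>" "B \<noteq> C" for B C
    proof -
      obtain B' C' where B': "B = g B'" "B' \<in> \<B>" and C': "C = g C'" "C' \<in> \<B>"
        using BC by blast
      with BC(3) have "parcs B' \<inter> parcs C' = {}"
        by (intro disj_block) auto
      with g_arcs[OF B'(2)] g_arcs[OF C'(2)] show ?thesis
        unfolding B'(1) C'(1) by blast
    qed
  qed (use g(1) F_def in auto)
  have FK: "F \<subseteq> parcs K"
    using g_arcs block(2) by (fastforce simp: F_def)
  \<comment> \<open>The vertex type is infinite and \<open>K\<close> is finite, so there is room for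
    \<open>m\<close> new vertices.\<close>
  obtain W where W: "W \<subseteq> - pverts K" "card W = m" "finite W"
    using infinite_arbitrarily_large[of "- pverts K" m] V(1) infinite_UNIV
    by (metis Compl_eq_Diff_UNIV Diff_infinite_finite)
  define U where "U = pverts K \<union> W"
  define K' where "K' = \<lparr> pverts = U, parcs = {(x, y). (x, y) \<in> U \<times> U \<and> x \<noteq> y} \<rparr>"
  have U: "finite U" "card U = v + m"
    using V W by (auto simp: U_def card_Un_disjoint disjoint_eq_subset_Compl Int_commute)
  have complete: "complete_digraph (v + m) (with_proj K')"
    using U by (simp add: complete_digraph_pair_def K'_def)
  then have K': "pair_graph K'"
    by (intro pair_graphI_graph) (simp add: complete_digraph_def)
  define E where "E = parcs K' - F"
  have FK': "F \<subseteq> parcs K'"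
    using FK V(3) by (auto simp: K'_def U_def)
  have E_sub: "E \<subseteq> U \<times> U"
    by (auto simp: E_def K'_def)
  have fin: "finite (parcs K')"
    using pair_fin_digraph.pair_finite_arcs K' pair_graph_def pair_digraph_def by blast
  \<comment> \<open>The chosen paths use up whole edges, never a single arc, so what remains is
    again symmetric.\<close>
  have "(y, x) \<in> F" if xy: "(x, y) \<in> F" for x y
  proof -
    obtain B where B: "B \<in> g ` \<B>" "(x, y) \<in> parcs B"
      using xy by (auto simp: F_def)
    then have "(y, x) \<in> parcs B"
      using path3_decompositionD(1)[OF F] by (fastforce simp: is_path3_def cherry_def)
    with B(1) show ?thesis by (auto simp: F_def)
  qed
  then have sym: "sym E"
    by (auto simp: E_def K'_def intro!: symI)
  have irrefl: "irrefl E"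
    by (auto simp: E_def K'_def irrefl_def)
  have "4 dvd card (parcs K')"
    using m(2) U card_off_diagonal[OF U(1)] by (simp add: K'_def)
  moreover have "4 dvd card F"
    using four_dvd_card_path3_decomposition[OF F] finite_subset[OF FK' fin] by blast
  ultimately have card: "4 dvd card E"
    using FK' fin unfolding E_def by (subst card_Diff_subset) (auto intro: finite_subset)
  obtain w where w: "w \<in> W"
    using m(1) W(2) by fastforce
  \<comment> \<open>All chosen paths lie inside \<open>K\<close>, so no edge at the new vertex
    \<open>w\<close> has been used.\<close>
  have apex: "(x, w) \<in> E" if "x \<in> U" "x \<noteq> w" for x
    using that w W(1) FK V(3) by (auto simp: E_def K'_def U_def)
  have wU: "w \<in> U"
    using w by (simp add: U_def)
  obtain D where D: "D \<inter> D\<inverse> = {}" "D \<union> D\<inverse> = E" "\<And>x. even (card (D `` {x}))"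
    using apex_even_orientation[OF U(1) E_sub sym irrefl card wU apex] by metis
  have "finite D"
    using fin D(2) by (metis E_def finite_Diff finite_Un)
  then obtain \<C> where "path3_decomposition \<C> E"
    using even_out_degrees_path3_decomposition D by metis
  then have "path3_decomposition (g ` \<B> \<union> \<C>) (F \<union> E)"
    using F path3_decomposition_Un by (metis E_def Diff_disjoint)
  moreover have "F \<union> E = parcs K'"
    using FK' by (auto simp: E_def)
  ultimately have "graph_design K' P\<^sub>3 (g ` \<B> \<union> \<C>)"
    using K' graph_design_path3 by metis
  then have "design_of_order (v + m) P\<^sub>3 (g ` \<B> \<union> \<C>)"
    using K' complete by (auto simp: design_of_order_def)
  moreover have "down_link g \<B> (g ` \<B> \<union> \<C>)"
    using g(2) by (auto simp: down_link_def)
  ultimately show ?thesis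
    by (auto simp: down_linkable_to_order_def)
qed

text \<open>The target order must be 0 or 1 modulo 4. The values are 1 for \<open>v\<close>
  congruent to 0 or 3, and 2 for \<open>v\<close> congruent to 2. The worst case is \<open>v\<close>
  congruent to 1: at least one vertex must be added, and \<open>v + 3\<close> is the next suitable
  order.\<close>

lemma next_admissible_order:
  fixes v :: nat
  obtains m where "0 < m" "m \<le> 3" "4 dvd (v + m) * (v + m - 1)"
proof -
  have "4 dvd v \<or> 4 dvd v + 1 \<or> 4 dvd v + 2 \<or> 4 dvd v + 3"
    by presburger
  then consider "4 dvd v" | "4 dvd v + 1" | "4 dvd v + 2" | "4 dvd v + 3"
    by blast
  then show ?thesis
  proof cases
    case 1
    then show ?thesis by (intro that[of 1]) auto
  next
    case 2
    from dvd_mult2[OF this, of "v + 1 - 1"] show ?thesis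
      by (intro that[of 1]) simp_all
  next
    case 3
    from dvd_mult2[OF this, of "v + 2 - 1"] show ?thesis
      by (intro that[of 2]) simp_all
  next
    case 4
    from dvd_mult2[OF this, of "v + 3 - 1"] show ?thesis
      by (intro that[of 3]) simp_all
  qed
qed

theorem theorem4p2:
  fixes \<Gamma> :: "'a::infinite pair_pre_digraph" and v :: nat
  assumes "pair_graph \<Gamma>"
    and "embeds P\<^sub>3 \<Gamma>"
    and "v > 0"
    and "\<exists>\<B> :: 'a pair_pre_digraph set. design_of_order v \<Gamma> \<B>"
  shows "\<eta>\<^sub>1 \<Gamma> v \<le> \<eta>\<^sub>2 \<Gamma> v \<and> \<eta>\<^sub>2 \<Gamma> v \<le> enat (v + 3)"
proof
  \<comment> \<open>The existence of a design turns "every design" into "some design"; the infimum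
    over the larger set is the smaller one.\<close>
  have "L\<^sub>2 \<Gamma> v \<subseteq> L\<^sub>1 \<Gamma> v"
    using assms(4) by (auto simp: L\<^sub>1_def L\<^sub>2_def)
  then show "\<eta>\<^sub>1 \<Gamma> v \<le> \<eta>\<^sub>2 \<Gamma> v"
    unfolding \<eta>\<^sub>1_def \<eta>\<^sub>2_def by (intro INF_superset_mono) auto
  obtain m where m: "0 < m" "m \<le> 3" "4 dvd (v + m) * (v + m - 1)"
    by (rule next_admissible_order)
  then have "v + m \<in> L\<^sub>2 \<Gamma> v"
    using design_down_linkable[OF assms(1,2)] by (auto simp: L\<^sub>2_def)
  then have "\<eta>\<^sub>2 \<Gamma> v \<le> enat (v + m)"
    unfolding \<eta>\<^sub>2_def by (rule INF_lower)
  also have "\<dots> \<le> enat (v + 3)"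
    using m(2) by simp
  finally show "\<eta>\<^sub>2 \<Gamma> v \<le> enat (v + 3)" .
qed

end
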